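(* Let $p$ be a prime and let $m\mid p-1$ be even. Then \[ M_4(p,m)=\frac{2\pi^4}{p^2}\sum_{\lambda\in\mathcal{G}_m}\mathcal{S}_{\lambda,1}(p). \]
   Context: $\mathcal{G}_m$ is the unique subgroup of $\mathbb{F}_p^*$ of index $m$; $\mathcal{X}_{p,m}$ is the group of multiplicative characters of $\mathbb{F}_p^*$ trivial on $\mathcal{G}_m$, $\mathcal{X}_{p,m}^-=\{\chi\in\mathcal{X}_{p,m}:\chi(-1)=-1\}$, $L(1,\chi)=\sum_{n\ge1}\chi(n)/n$, and $M_\nu(p,m)=\frac{2}{m}\sum_{\chi\in\mathcal{X}_{p,m}^-}|L(1,\chi)|^\nu$. The Dedekind sum is $\mathsf{s}(c,q)=\sum_{a=1}^{q-1}((a/q))((ac/q))$ with $((\xi))=\{\xi\}-1/2$ for $\xi\notin\mathbb{Z}$ and $((\xi))=0$ for $\xi\in\mathbb{Z}$, and for residues $k_1,k_2$ modulo $p$ (identified with integer representatives) $\mathcal{S}_{k_1,k_2}(p)=\sum_{t=1}^{p-1}\mathsf{s}(k_1t,p)\mathsf{s}(k_2t,p)$. *)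

theory Defs
  imports Complex_Main "HOL-Number_Theory.Residues"
begin

definition units_mod :: "nat \<Rightarrow> int monoid" where
  "units_mod p = mult_of (residue_ring (int p))"

text \<open>Meaningful for \<open>p\<close> prime and \<open>m\<close> dividing \<open>p - 1\<close>: the group is then cyclic, so there is
  exactly one subgroup of index \<open>m\<close>.\<close>

definition index_subgroup :: "nat \<Rightarrow> nat \<Rightarrow> int set" where
  "index_subgroup p m =
     (THE H. subgroup H (units_mod p) \<and> card (rcosets\<^bsub>units_mod p\<^esub> H) = m)"

definition complex_units :: "complex monoid" where
  "complex_units = \<lparr>carrier = UNIV - {0}, monoid.mult = (*), one = 1\<rparr>"

text \<open>A character is represented by its extension to the integers, which is \<open>p\<close>-periodic
  and vanishes on the multiples of \<open>p\<close>.\<close>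

definition characters :: "nat \<Rightarrow> (int \<Rightarrow> complex) set" where
  "characters p = {\<chi> \<in> hom (units_mod p) complex_units.
     \<forall>n. \<chi> n = (if int p dvd n then 0 else \<chi> (n mod int p))}"

definition characters_trivial :: "nat \<Rightarrow> nat \<Rightarrow> (int \<Rightarrow> complex) set" where
  "characters_trivial p m = {\<chi> \<in> characters p. \<forall>g\<in>index_subgroup p m. \<chi> g = 1}"

definition odd_characters :: "nat \<Rightarrow> nat \<Rightarrow> (int \<Rightarrow> complex) set" where
  "odd_characters p m = {\<chi> \<in> characters_trivial p m. \<chi> (- 1) = - 1}"

text \<open>The series is only conditionally convergent (for nontrivial \<open>\<chi>\<close>), so it is summed in
  the natural order; the term of index \<open>n\<close> is \<open>\<chi>(n + 1) / (n + 1)\<close>.\<close>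

definition L_one :: "(int \<Rightarrow> complex) \<Rightarrow> complex" where
  "L_one \<chi> = (\<Sum>n. \<chi> (int (Suc n)) / of_nat (Suc n))"

definition moment :: "nat \<Rightarrow> nat \<Rightarrow> nat \<Rightarrow> real" where
  "moment \<nu> p m = 2 / real m * (\<Sum>\<chi>\<in>odd_characters p m. norm (L_one \<chi>) ^ \<nu>)"

definition sawtooth :: "real \<Rightarrow> real" where
  "sawtooth \<xi> = (if \<xi> \<in> \<int> then 0 else frac \<xi> - 1 / 2)"

definition dedekind_sum :: "int \<Rightarrow> nat \<Rightarrow> real" where
  "dedekind_sum c q =
     (\<Sum>a = 1..q - 1. sawtooth (real a / real q) * sawtooth (real a * real_of_int c / real q))"

definition dedekind_corr :: "int \<Rightarrow> int \<Rightarrow> nat \<Rightarrow> real" where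
  "dedekind_corr k1 k2 p =
     (\<Sum>t = 1..p - 1. dedekind_sum (k1 * int t) p * dedekind_sum (k2 * int t) p)"

end

theory Submission
  imports Defs "HOL-Analysis.Gamma_Function"
begin

text \<open>
  For odd \<open>\<chi>\<close> the reflection formula of the digamma function gives
  \<open>L(1,\<chi>) = \<pi>/(2p) C\<close> with \<open>C = \<Sum>\<^sub>k \<chi>(k) cot(\<pi>k/p)\<close>. The discrete Fourier expansion of the cotangent
  in terms of the sawtooth yields \<open>4p s(c,p) = \<Sum>\<^sub>k cot(\<pi>k/p) cot(\<pi>ck/p)\<close>, and summing this against \<open>\<chi>(c)\<close>
  gives \<open>4p A = |C|\<^sup>2\<close> for \<open>A = \<Sum>\<^sub>c \<chi>(c) s(c,p)\<close>; no Gauss sum is needed. Hence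
  \<open>|L(1,\<chi>)|\<^sup>4 = \<pi>\<^sup>4/p\<^sup>2 |A|\<^sup>2\<close>. As \<open>s\<close> is odd, \<open>A\<close> vanishes for even \<open>\<chi>\<close>, so the moment may be summed over
  all of the characters trivial on the subgroup, and orthogonality applied to
  \<open>|A|\<^sup>2 = \<Sum>\<^sub>\<lambda> \<chi>(\<lambda>) S(\<lambda>,1)\<close> picks out the \<open>\<lambda>\<close> in the subgroup.
\<close>

\<comment> \<open>frees \<open>\<chi>\<close>, which is otherwise the binder for vectors\<close>
unbundle no vec_syntax

section \<open>Cotangent sums and Dedekind sums\<close>

text \<open>Summation by parts: multiplying by \<open>z - 1\<close> telescopes the sum for any
  number of terms. At \<open>p\<close> terms the boundary term is \<open>p\<close> and the remaining
  geometric sum vanishes.\<close>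

lemma sum_of_nat_times_power_eq:
  fixes z :: "'a::field"
  assumes "z ^ p = 1" "z \<noteq> 1"
  shows "(\<Sum>a<p. of_nat a * z ^ a) = of_nat p / (z - 1)"
proof -
  have "(\<Sum>a<n. of_nat a * z ^ a) * (z - 1) = of_nat n * z ^ n - (\<Sum>a<n. z ^ Suc a)" for n
    by (induction n) (simp_all add: algebra_simps)
  moreover have "(\<Sum>a<p. z ^ a) = 0"
    using assms by (simp add: geometric_sum)
  then have "(\<Sum>a<p. z ^ Suc a) = 0"
    by (simp flip: sum_distrib_left)
  ultimately have "(\<Sum>a<p. of_nat a * z ^ a) * (z - 1) = of_nat p"
    using assms by (metis diff_zero mult.right_neutral)
  then show ?thesis
    using assms by (metis eq_divide_eq right_minus_eq)
qed

section \<open>Additive characters modulo p\<close>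

definition unit_exp :: "nat \<Rightarrow> int \<Rightarrow> complex" where
  "unit_exp p k = cis (2 * pi * real_of_int k / real p)"

lemma unit_exp_add: "unit_exp p (j + k) = unit_exp p j * unit_exp p k"
  by (simp add: unit_exp_def cis_mult add_divide_distrib distrib_left)

lemma unit_exp_mult_nat: "unit_exp p (int n * k) = unit_exp p k ^ n"
  by (simp add: unit_exp_def Complex.DeMoivre mult_ac)

lemma unit_exp_eq_1_iff:
  assumes "p > 0"
  shows "unit_exp p k = 1 \<longleftrightarrow> int p dvd k"
proof
  assume "unit_exp p k = 1"
  then have "cos (2 * pi * real_of_int k / real p) = 1"
    by (simp add: unit_exp_def complex_eq_iff)
  then obtain j :: int where "2 * pi * real_of_int k / real p = real_of_int j * 2 * pi"
    by (auto simp: cos_one_2pi_int)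
  then have "real_of_int k = real_of_int (j * int p)"
    using assms by (simp add: field_simps)
  then show "int p dvd k"
    by (simp only: of_int_eq_iff) simp
next
  assume "int p dvd k"
  then obtain j where "k = int p * j" by blast
  then show "unit_exp p k = 1"
    using assms cis_multiple_2pi[of "real_of_int j"] by (simp add: unit_exp_def mult.assoc)
qed

lemma unit_exp_power_eq_1:
  assumes "p > 0"
  shows "unit_exp p k ^ p = 1"
  using assms by (simp flip: unit_exp_mult_nat add: unit_exp_eq_1_iff)

text \<open>Orthogonality of additive characters. It is used with modulus \<open>p\<close> to
  evaluate sums of products of cotangents, and later with modulus \<open>m\<close> to sum powers of
  roots of unity.\<close>

lemma sum_unit_exp:
  assumes "p > 0"
  shows "(\<Sum>a<p. unit_exp p (int a * k)) = (if int p dvd k then of_nat p else 0)"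
proof (cases "int p dvd k")
  case True
  then show ?thesis
    using assms by (simp add: unit_exp_mult_nat flip: unit_exp_eq_1_iff)
next
  case False
  then show ?thesis
    using assms by (simp add: unit_exp_mult_nat geometric_sum unit_exp_power_eq_1 flip: unit_exp_eq_1_iff)
qed

text \<open>The last summand restores the value 0 that the sawtooth takes at integers, where the
  linear formula would give -1/2. One formula then covers the full residue system, including
  0.\<close>

lemma sawtooth_less:
  assumes "a < p"
  shows "sawtooth (real a / real p) = real a / real p - 1 / 2 + (if a = 0 then 1 / 2 else 0)"
proof (cases "a = 0")
  case False
  have "real a / real p \<in> {0..<1}"
    using assms by auto
  then have "frac (real a / real p) = real a / real p"
    by (rule frac_eq_id)
  moreover from this have "real a / real p \<notin> \<int>"
    using False assms by (simp flip: frac_eq_0_iff)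
  ultimately show ?thesis
    using False by (simp add: sawtooth_def)
qed (simp add: sawtooth_def)

lemma sawtooth_mod:
  assumes "p > 0"
  shows "sawtooth (real_of_int (k mod int p) / real p) = sawtooth (real_of_int k / real p)"
proof -
  have "real_of_int k / real p = real_of_int (k mod int p) / real p + real_of_int (k div int p)"
    using assms arg_cong[OF div_mult_mod_eq[of k "int p"], of real_of_int]
    by (simp only: of_int_add of_int_mult) (simp add: field_simps)
  then show ?thesis
    by (simp add: sawtooth_def)
qed

lemma sawtooth_uminus: "sawtooth (- x) = - sawtooth x"
  by (simp add: sawtooth_def frac_neg)

lemma sin_pi_mult_div_nonzero:
  assumes "p > 0" "\<not> int p dvd k"
  shows "sin (pi * real_of_int k / real p) \<noteq> 0"
proof
  assume "sin (pi * real_of_int k / real p) = 0"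
  then obtain j :: int where "pi * real_of_int k / real p = real_of_int j * pi"
    by (auto simp: sin_zero_iff_int2)
  then have "real_of_int k = real_of_int (j * int p)"
    using assms by (simp add: field_simps)
  then show False
    using assms(2) by (simp only: of_int_eq_iff) simp
qed

text \<open>By \<open>sawtooth_less\<close> the right-hand side splits into an arithmetic-geometric
  and a geometric sum in powers of e(k/p), both with closed forms. Multiples of \<open>p\<close> are
  covered as well: division by zero makes \<open>cot\<close> equal to 0 there.\<close>

lemma cot_eq_sum_sawtooth:
  assumes "p > 0"
  shows "of_real (cot (pi * real_of_int k / real p)) =
    2 * \<i> * (\<Sum>a<p. of_real (sawtooth (real a / real p)) * unit_exp p (int a * k))"
proof -
  define z where "z = unit_exp p k"
  have zp: "z ^ p = 1"
    using assms by (simp add: z_def unit_exp_power_eq_1)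
  have "(\<Sum>a<p. of_real (sawtooth (real a / real p)) * unit_exp p (int a * k)) =
      (\<Sum>a<p. (of_nat a * z ^ a) / of_nat p - z ^ a / 2 + (if a = 0 then 1 / 2 else 0))"
    by (intro sum.cong refl, subst unit_exp_mult_nat) (auto simp: sawtooth_less z_def algebra_simps)
  also have "\<dots> = (\<Sum>a<p. of_nat a * z ^ a) / of_nat p - (\<Sum>a<p. z ^ a) / 2 + 1 / 2"
    using assms by (simp add: sum.distrib sum_subtractf sum_divide_distrib sum.delta)
  finally have F: "(\<Sum>a<p. of_real (sawtooth (real a / real p)) * unit_exp p (int a * k)) =
      (\<Sum>a<p. of_nat a * z ^ a) / of_nat p - (\<Sum>a<p. z ^ a) / 2 + 1 / 2" .
  show ?thesis
  proof (cases "int p dvd k")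
    case True
    then obtain j where j: "k = int p * j" by blast
    \<comment> \<open>Here \<open>cot\<close> is 0 because its denominator is, and the sawtooth
      values sum to (p - 1)/2 - p/2 + 1/2 = 0.\<close>
    have "sin (pi * real_of_int k / real p) = 0"
      using assms by (simp add: j sin_zero_iff_int2)
    moreover have "z = 1"
      using True assms by (simp add: z_def unit_exp_eq_1_iff)
    moreover have "2 * (\<Sum>a<p. of_nat a) = (of_nat p * (of_nat p - 1) :: complex)"
      by (induction p) (simp_all add: algebra_simps)
    then have "(\<Sum>a<p. of_nat a) = (of_nat p * (of_nat p - 1) / 2 :: complex)"
      by (simp only: nonzero_eq_divide_eq[OF zero_neq_numeral[symmetric]] mult.commute)
    ultimately show ?thesis
      using assms unfolding F by (simp add: cot_def field_simps)
  next
    case False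
    define x where "x = pi * real_of_int k / real p"
    have z1: "z \<noteq> 1"
      using False assms by (simp add: z_def unit_exp_eq_1_iff)
    have s: "sin x \<noteq> 0"
      unfolding x_def by (rule sin_pi_mult_div_nonzero[OF assms False])
    \<comment> \<open>Half-angle form: a factor \<open>cis x\<close> splits off from both
      \<open>z - 1\<close> and \<open>z + 1\<close> and cancels in their quotient, leaving Euler's
      formulas for sine and cosine.\<close>
    have zx: "z = cis x * cis x"
      by (simp add: z_def unit_exp_def cis_mult x_def mult.assoc)
    have cx: "cis x * cis (-x) = 1"
      by (simp add: cis_mult)
    have e1: "z - 1 = cis x * (2 * \<i> * of_real (sin x))"
    proof -
      have "z - 1 = cis x * (cis x - cis (-x))"
        using cx by (simp add: zx algebra_simps)
      also have "cis x - cis (-x) = 2 * \<i> * of_real (sin x)"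
        by (simp add: complex_eq_iff)
      finally show ?thesis .
    qed
    have e2: "z + 1 = cis x * (2 * of_real (cos x))"
    proof -
      have "z + 1 = cis x * (cis x + cis (-x))"
        using cx by (simp add: zx algebra_simps)
      also have "cis x + cis (-x) = 2 * of_real (cos x)"
        by (simp add: complex_eq_iff)
      finally show ?thesis .
    qed
    have "2 * \<i> * ((\<Sum>a<p. of_nat a * z ^ a) / of_nat p - (\<Sum>a<p. z ^ a) / 2 + 1 / 2) =
        2 * \<i> * (1 / (z - 1) + 1 / 2)"
      using assms z1 zp by (simp add: sum_of_nat_times_power_eq geometric_sum)
    also have "\<dots> = \<i> * ((z + 1) / (z - 1))"
      using z1 by (simp add: field_simps)
    also have "\<dots> = of_real (cot x)"
      unfolding e1 e2 using s by (simp add: cot_def field_simps)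
    finally show ?thesis
      unfolding F x_def by simp
  qed
qed

text \<open>Both cotangents are expanded by \<open>cot_eq_sum_sawtooth\<close>; summing over
  \<open>k\<close> first leaves only the pairs with b = -ca modulo \<open>p\<close>. The sign in
  (2i)^2 = -4 is undone by the oddness of the sawtooth.\<close>

lemma sum_cot_mult_cot:
  assumes "p > 0"
  shows "(\<Sum>k<p. cot (pi * real k / real p) * cot (pi * real_of_int (c * int k) / real p)) =
    4 * real p * dedekind_sum c p"
proof -
  define s where "s k = complex_of_real (sawtooth (real_of_int k / real p))" for k
  have "complex_of_real (\<Sum>k<p. cot (pi * real k / real p) * cot (pi * real_of_int (c * int k) / real p)) =
     (\<Sum>k<p. of_real (cot (pi * real_of_int (int k) / real p)) *
        of_real (cot (pi * real_of_int (c * int k) / real p)))"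
    by simp
  also have "\<dots> = (\<Sum>k<p. (2 * \<i> * (\<Sum>b<p. s (int b) * unit_exp p (int b * int k))) *
        (2 * \<i> * (\<Sum>a<p. s (int a) * unit_exp p (int a * (c * int k)))))"
    unfolding cot_eq_sum_sawtooth[OF assms] by (simp add: s_def)
  also have "\<dots> = (\<Sum>k<p. \<Sum>a<p. \<Sum>b<p. -4 * (s (int a) * s (int b) * unit_exp p (int k * (int b + c * int a))))"
    by (rule sum.cong)
      (simp_all add: sum_distrib_left sum_distrib_right algebra_simps unit_exp_add)
  also have "\<dots> = (\<Sum>a<p. \<Sum>k<p. \<Sum>b<p. -4 * (s (int a) * s (int b) * unit_exp p (int k * (int b + c * int a))))"
    by (rule sum.swap)
  also have "\<dots> = (\<Sum>a<p. \<Sum>b<p. \<Sum>k<p. -4 * (s (int a) * s (int b) * unit_exp p (int k * (int b + c * int a))))"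
    by (intro sum.cong refl sum.swap)
  also have "\<dots> = (\<Sum>a<p. \<Sum>b<p. -4 * (s (int a) * s (int b) * (if int p dvd int b + c * int a then of_nat p else 0)))"
    by (simp only: sum_unit_exp[OF assms] flip: sum_distrib_left)
  also have "\<dots> = (\<Sum>a<p. 4 * of_nat p * (s (int a) * s (int a * c)))"
  proof (rule sum.cong)
    fix a
    \<comment> \<open>The only index below \<open>p\<close> that survives orthogonality.\<close>
    define b0 where "b0 = nat ((- (c * int a)) mod int p)"
    have b0: "b0 < p" "int b0 = (- (c * int a)) mod int p"
      using assms by (simp_all add: b0_def nat_less_iff)
    have "int p dvd int b + c * int a \<longleftrightarrow> b = b0" if "b < p" for b
    proof -
      have "int p dvd int b + c * int a \<longleftrightarrow> int b mod int p = (- (c * int a)) mod int p"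
        by (simp add: mod_eq_dvd_iff)
      also have "int b mod int p = int b"
        using that by simp
      finally show ?thesis
        using b0 by (metis of_nat_eq_iff)
    qed
    then have "(\<Sum>b<p. -4 * (s (int a) * s (int b) * (if int p dvd int b + c * int a then of_nat p else 0))) =
        (\<Sum>b<p. if b = b0 then -4 * (s (int a) * s (int b0) * of_nat p) else 0)"
      by (intro sum.cong) auto
    also have "\<dots> = -4 * (s (int a) * s (int b0) * of_nat p)"
      using b0 by simp
    also have "s (int b0) = s (- (c * int a))"
      unfolding s_def b0(2) by (simp only: sawtooth_mod[OF assms])
    also have "\<dots> = - s (int a * c)"
      by (simp add: s_def sawtooth_uminus mult.commute flip: minus_divide_left)
    finally show "(\<Sum>b<p. -4 * (s (int a) * s (int b) * (if int p dvd int b + c * int a then of_nat p else 0))) =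
        4 * of_nat p * (s (int a) * s (int a * c))"
      by simp
  qed simp
  \<comment> \<open>The index 0, absent from \<open>dedekind_sum\<close>, contributes nothing
    because the sawtooth vanishes there.\<close>
  also have "\<dots> = (\<Sum>a=1..p-1. 4 * of_nat p * (s (int a) * s (int a * c)))"
    by (rule sum.mono_neutral_right) (auto simp: s_def sawtooth_def Suc_le_eq)
  also have "\<dots> = complex_of_real (4 * real p * dedekind_sum c p)"
    by (simp add: s_def dedekind_sum_def sum_distrib_left)
  finally show ?thesis
    by (simp only: of_real_eq_iff)
qed


section \<open>Series with odd periodic coefficients\<close>

text \<open>Logarithmic derivative of Euler's reflection formula for the Gamma function, taken at a
  real point of (0,1), where neither Gamma factor has a pole.\<close>

lemma Digamma_reflection:
  fixes x :: real
  assumes "0 < x" "x < 1"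
  shows "Digamma (of_real (1 - x)) - Digamma (of_real x :: complex) = of_real (pi * cot (pi * x))"
proof -
  define z where "z = complex_of_real x"
  have z: "z \<notin> \<int>\<^sub>\<le>\<^sub>0" and z': "1 - z \<notin> \<int>\<^sub>\<le>\<^sub>0"
    using assms by (auto elim!: nonpos_Ints_cases simp: z_def complex_eq_iff)
  have "sin (pi * x) \<noteq> 0"
    using assms by (intro less_imp_neq[THEN not_sym] sin_gt_zero) auto
  moreover have "sin (of_real pi * z) = of_real (sin (pi * x))" "cos (of_real pi * z) = of_real (cos (pi * x))"
    by (simp_all add: z_def sin_of_real cos_of_real flip: of_real_mult)
  ultimately have s: "sin (of_real pi * z) \<noteq> 0"
    and c: "of_real (cot (pi * x)) = cos (of_real pi * z) / sin (of_real pi * z)"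
    by (simp_all add: cot_def)
  have "((\<lambda>z. Gamma z * Gamma (1 - z)) has_field_derivative
      Gamma z * Gamma (1 - z) * (Digamma z - Digamma (1 - z))) (at z)"
    using z z' by (auto intro!: derivative_eq_intros simp: algebra_simps)
  moreover have "((\<lambda>z. of_real pi / sin (of_real pi * z)) has_field_derivative
      of_real pi / sin (of_real pi * z) * (- of_real pi * (cos (of_real pi * z) / sin (of_real pi * z)))) (at z)"
    using s by (auto intro!: derivative_eq_intros simp: field_simps)
  \<comment> \<open>The reflection formula identifies the two functions differentiated above, so
    their derivatives agree. Rewriting with it also gives both derivatives the same nonzero factor,
    which is then cancelled.\<close>
  ultimately have "of_real pi / sin (of_real pi * z) * (Digamma z - Digamma (1 - z)) =
      of_real pi / sin (of_real pi * z) * (- of_real pi * (cos (of_real pi * z) / sin (of_real pi * z)))"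
    unfolding Gamma_reflection_complex by (rule DERIV_unique)
  then have "Digamma z - Digamma (1 - z) = - of_real pi * (cos (of_real pi * z) / sin (of_real pi * z))"
    using s by (subst (asm) mult_cancel_left) auto
  then show ?thesis
    by (simp add: z_def c[unfolded z_def] algebra_simps)
qed

text \<open>Reflecting \<open>a\<close> to \<open>p - a\<close> changes the sign of
  \<open>f\<close>, and the two forms of the sum are added. With constant \<open>h\<close> this
  shows that \<open>f\<close> sums to 0 over a period; with digamma values for \<open>h\<close> it
  prepares the reflection formula.\<close>

lemma sum_odd_periodic:
  fixes f :: "int \<Rightarrow> complex"
  assumes per: "\<And>n. f (n mod int p) = f n" and odd: "\<And>n. f (- n) = - f n"
  shows "2 * (\<Sum>a=1..<p. f (int a) * h a) = (\<Sum>a=1..<p. f (int a) * (h a - h (p - a)))"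
proof -
  have "(\<Sum>a=1..<p. f (int a) * h a) = (\<Sum>a=1..<p. f (int (p - a)) * h (p - a))"
    by (subst sum.atLeastLessThan_rev) (intro sum.cong, auto)
  also have "\<dots> = (\<Sum>a=1..<p. - (f (int a) * h (p - a)))"
  proof (rule sum.cong)
    fix a assume a: "a \<in> {1..<p}"
    have "f (int (p - a)) = f ((- int a) mod int p)"
      using a by (subst per[symmetric]) (simp add: of_nat_diff mod_diff_left_eq flip: mod_diff_left_eq[of "int p"])
    then show "f (int (p - a)) * h (p - a) = - (f (int a) * h (p - a))"
      by (simp add: per odd)
  qed simp
  finally show ?thesis
    by (simp add: sum_subtractf right_diff_distrib sum_negf)
qed

text \<open>Convergence can be tested along whole blocks: after M full blocks an incomplete one has
  at most \<open>p\<close> terms, each at most B/(Mp), so at most B/M in total. By division by zero,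
  the bound at index 0 forces \<open>g 0\<close> to be 0.\<close>

lemma sums_blocks:
  fixes g :: "nat \<Rightarrow> 'a::real_normed_vector"
  assumes p: "p > 0" and B: "\<And>n. norm (g n) \<le> B / real n"
    and lim: "(\<lambda>M. \<Sum>n<M * p. g n) \<longlonglongrightarrow> l"
  shows "g sums l"
proof -
  have ft: "filterlim (\<lambda>N. N div p) at_top sequentially"
    unfolding filterlim_at_top
  proof
    fix Z
    show "eventually (\<lambda>N. Z \<le> N div p) sequentially"
      using eventually_ge_at_top[of "Z * p"]
      by eventually_elim (use p in \<open>simp add: less_eq_div_iff_mult_less_eq\<close>)
  qed
  have B0: "0 \<le> B"
    using order_trans[OF norm_ge_zero B[of 1]] by simp
  have "(\<lambda>N. (\<Sum>n<N. g n) - (\<Sum>n<(N div p) * p. g n)) \<longlonglongrightarrow> 0"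
  proof (rule Lim_null_comparison)
    show "eventually (\<lambda>N. norm ((\<Sum>n<N. g n) - (\<Sum>n<(N div p) * p. g n)) \<le> B / real (N div p)) sequentially"
      using eventually_ge_at_top[of p]
    proof eventually_elim
      fix N assume N: "p \<le> N"
      define M where "M = N div p"
      have M: "M > 0" "M * p \<le> N" "N - M * p \<le> p"
        using N p mod_less_divisor[OF p, of N]
        by (auto simp: M_def div_greater_zero_iff minus_div_mult_eq_mod)
      have "(\<Sum>n<N. g n) - (\<Sum>n<M * p. g n) = (\<Sum>n=M*p..<N. g n)"
        using M sum_diff_nat_ivl[of 0 "M * p" N g] by (simp add: atLeast0LessThan)
      also have "norm \<dots> \<le> (\<Sum>n=M*p..<N. B / real (M * p))"
      proof (rule sum_norm_le)
        fix n assume n: "n \<in> {M * p..<N}"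
        have "norm (g n) \<le> B / real n"
          by (rule B)
        also have "\<dots> \<le> B / real (M * p)"
          using n M p B0 order.strict_trans2[of 0 "M * p" n]
          by (intro divide_left_mono) (auto simp del: of_nat_mult)
        finally show "norm (g n) \<le> B / real (M * p)" .
      qed
      also have "\<dots> = real (N - M * p) * (B / real (M * p))"
        by simp
      also have "\<dots> \<le> real p * (B / real (M * p))"
        using M(3) B0 by (intro mult_right_mono of_nat_mono) auto
      also have "\<dots> = B / real M"
        using p by simp
      finally show "norm ((\<Sum>n<N. g n) - (\<Sum>n<(N div p) * p. g n)) \<le> B / real (N div p)"
        by (simp add: M_def)
    qed
    show "(\<lambda>N. B / real (N div p)) \<longlonglongrightarrow> 0"
      by (rule filterlim_compose[OF lim_const_over_n ft])
  qed
  from tendsto_add[OF this filterlim_compose[OF lim ft]] show ?thesis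
    by (simp add: sums_def)
qed

text \<open>Within each residue class the series is a harmonic sum shifted by a/p, which after
  subtraction of ln M tends to minus a digamma value. The logarithms cancel since \<open>f\<close>
  sums to 0 over a period; pairing \<open>a\<close> with \<open>p - a\<close> then turns digamma
  differences into cotangents.\<close>

theorem odd_periodic_sums_cot:
  fixes f :: "int \<Rightarrow> complex"
  assumes p: "p > 0" and per: "\<And>n. f (n mod int p) = f n" and odd: "\<And>n. f (- n) = - f n"
  shows "(\<lambda>n. f (int (Suc n)) / of_nat (Suc n)) sums
    (of_real (pi / (2 * real p)) * (\<Sum>a<p. f (int a) * of_real (cot (pi * real a / real p))))"
proof -
  define \<psi> where "\<psi> a = Digamma (of_real (real a / real p) :: complex)" for a
  define g where "g n = f (int n) / of_nat n" for n
  have f0: "f 0 = 0"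
    using odd[of 0] by simp
  have from1: "(\<Sum>a<p. f (int a) * h a) = (\<Sum>a=1..<p. f (int a) * h a)" for h
    by (rule sum.mono_neutral_right) (auto simp: f0 Suc_le_eq)
  have "(\<Sum>a=1..<p. f (int a)) = 0"
    using sum_odd_periodic[of f p "\<lambda>_. 1", OF per odd] by simp
  then have sum0: "(\<Sum>a<p. f (int a)) = 0"
    using from1[of "\<lambda>_. 1"] by simp
  \<comment> \<open>For n = mp + a the term is f(a)/p times 1/(m + a/p). The inserted logarithm
    comes with the sum of \<open>f\<close> over a period as its factor, so it adds 0.\<close>
  have blocks: "(\<Sum>n<M * p. g n) =
      - (\<Sum>a<p. f (int a) / of_nat p * (of_real (ln (real M)) - (\<Sum>m<M. inverse (of_real (real a / real p) + of_nat m))))" for M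
  proof -
    have "(\<Sum>n<M * p. g n) = (\<Sum>m<M. \<Sum>a<p. g (m * p + a))"
      by (simp add: sum.nat_group[symmetric] sum.shift_bounds_nat_ivl[of _ 0, simplified] atLeast0LessThan add.commute)
    also have "\<dots> = (\<Sum>a<p. \<Sum>m<M. g (m * p + a))"
      by (rule sum.swap)
    also have "\<dots> = (\<Sum>a<p. f (int a) / of_nat p * (\<Sum>m<M. inverse (of_real (real a / real p) + of_nat m)))"
    proof (rule sum.cong)
      fix a assume "a \<in> {..<p}"
      have "f (int (m * p + a)) = f (int a)" for m
        using per[of "int (m * p + a)"] per[of "int a"] by simp
      moreover have "f (int a) / of_nat (m * p + a) =
          f (int a) / of_nat p * inverse (of_real (real a / real p) + of_nat m)" for m
        using p by (simp add: field_simps)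
      ultimately show "(\<Sum>m<M. g (m * p + a)) =
          f (int a) / of_nat p * (\<Sum>m<M. inverse (of_real (real a / real p) + of_nat m))"
        unfolding g_def sum_distrib_left by (simp only:)
    qed simp
    also have "\<dots> = - (\<Sum>a<p. f (int a) / of_nat p *
          (of_real (ln (real M)) - (\<Sum>m<M. inverse (of_real (real a / real p) + of_nat m)))) +
          (\<Sum>a<p. f (int a)) * (of_real (ln (real M)) / of_nat p)"
      by (simp add: right_diff_distrib sum_subtractf sum_distrib_right sum_divide_distrib)
    finally show ?thesis
      by (simp add: sum0)
  qed
  have "(\<lambda>M. \<Sum>n<M * p. g n) \<longlonglongrightarrow> - (\<Sum>a<p. f (int a) / of_nat p * \<psi> a)"
    unfolding blocks
  proof (intro tendsto_minus tendsto_sum)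
    fix a
    show "(\<lambda>M. f (int a) / of_nat p * (of_real (ln (real M)) -
        (\<Sum>m<M. inverse (of_real (real a / real p) + of_nat m)))) \<longlonglongrightarrow> f (int a) / of_nat p * \<psi> a"
    \<comment> \<open>Digamma has a pole at 0, so its limit formula is applied only for positive
      \<open>a\<close>; at 0 the coefficient \<open>f 0\<close> vanishes.\<close>
    proof (cases "a = 0")
      case False
      then show ?thesis
        using p unfolding \<psi>_def by (intro tendsto_intros Digamma_LIMSEQ) simp
    qed (simp add: f0)
  qed
  moreover have "norm (g n) \<le> (\<Sum>a<p. norm (f (int a))) / real n" for n
  proof -
    have "f (int n) = f (int (n mod p))"
      by (simp add: of_nat_mod per)
    also have "norm \<dots> \<le> (\<Sum>a<p. norm (f (int a)))"
      using p by (intro member_le_sum) auto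
    finally show ?thesis
      by (simp add: g_def norm_divide divide_right_mono)
  qed
  ultimately have sums: "g sums (- (\<Sum>a<p. f (int a) / of_nat p * \<psi> a))"
    by (intro sums_blocks[OF p])
  have "2 * (\<Sum>a<p. f (int a) * \<psi> a) = (\<Sum>a=1..<p. f (int a) * (\<psi> a - \<psi> (p - a)))"
    unfolding from1 by (rule sum_odd_periodic[OF per odd])
  also have "\<dots> = (\<Sum>a=1..<p. f (int a) * (- of_real pi * of_real (cot (pi * real a / real p))))"
  proof (rule sum.cong)
    fix a assume a: "a \<in> {1..<p}"
    have "real (p - a) / real p = 1 - real a / real p"
      using a by (simp add: of_nat_diff field_simps)
    then have "\<psi> (p - a) - \<psi> a = of_real (pi * cot (pi * (real a / real p)))"
      using a unfolding \<psi>_def by (simp only:) (rule Digamma_reflection; simp)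
    then show "f (int a) * (\<psi> a - \<psi> (p - a)) =
        f (int a) * (- of_real pi * of_real (cot (pi * real a / real p)))"
      by (simp add: algebra_simps)
  qed simp
  also have "\<dots> = - of_real pi * (\<Sum>a<p. f (int a) * of_real (cot (pi * real a / real p)))"
    unfolding from1 by (simp add: sum_distrib_left mult_ac)
  finally have "- (\<Sum>a<p. f (int a) / of_nat p * \<psi> a) =
      of_real (pi / (2 * real p)) * (\<Sum>a<p. f (int a) * of_real (cot (pi * real a / real p)))"
    using p by (simp add: field_simps flip: sum_divide_distrib)
  \<comment> \<open>Passing to \<open>Suc n\<close> drops the term of index 0, which is 0.\<close>
  with sums show ?thesis
    unfolding g_def by (subst sums_Suc_iff[of "\<lambda>n. f (int n) / of_nat n"]) (simp add: f0)
qed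

section \<open>Characters modulo a prime\<close>

lemma (in group) ord_generator:
  assumes fin: "finite (carrier G)" and a: "a \<in> carrier G"
    and gen: "carrier G = range (\<lambda>i::nat. a [^] i)"
  shows "ord a = order G"
proof -
  have "generate G {a} = range (\<lambda>i::nat. a [^] i)"
    using generate_pow_nat[OF a] ord_ge_1[OF fin a] by auto
  then show ?thesis
    using generate_pow_card[OF a] gen by (simp add: order_def)
qed

text \<open>The m-th powers form a subgroup of index \<open>m\<close> by counting. Conversely, a
  subgroup of index \<open>m\<close> has order |G|/m, which forces each of its elements to be an
  m-th power, and equal cardinalities do the rest. As an equivalence it yields existence and
  uniqueness together.\<close>

lemma (in group) cyclic_index_subgroup_iff:
  assumes fin: "finite (carrier G)" and a: "a \<in> carrier G"
    and gen: "carrier G = range (\<lambda>i::nat. a [^] i)" and m: "m dvd order G"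
  shows "subgroup H G \<and> card (rcosets H) = m \<longleftrightarrow> H = range (\<lambda>i::nat. a [^] (m * i))"
proof -
  define K where "K = range (\<lambda>i::nat. a [^] (m * i))"
  have pos: "order G > 0"
    using fin by (simp add: order_gt_0_iff_finite)
  then have m0: "m > 0"
    using m by (auto intro: Nat.gr0I)
  have ord_nz: "ord x \<noteq> 0" if "x \<in> carrier G" for x
    using ord_ge_1[OF fin that] by simp
  have gen_eq: "generate G {x} = range (\<lambda>i::nat. x [^] i)" if "x \<in> carrier G" for x
    using generate_pow_nat[OF that ord_nz[OF that]] by auto
  have ord_a: "ord a = order G"
    using fin a gen by (rule ord_generator)
  have am: "a [^] m \<in> carrier G"
    using a by simp
  have K: "K = generate G {a [^] m}"
    unfolding gen_eq[OF am] K_def using a by (simp add: nat_pow_pow)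
  have card_K: "card K = order G div m"
    using ord_pow[OF a, of m] m m0 generate_pow_card[OF am] K ord_a by simp
  have sub_K: "subgroup K G"
    unfolding K using am by (intro generate_is_subgroup) auto
  show ?thesis
    unfolding K_def[symmetric]
  proof
    assume "H = K"
    moreover have "card (rcosets K) * (order G div m) = m * (order G div m)"
      using lagrange[OF sub_K] m by (simp add: card_K)
    moreover have "order G div m \<noteq> 0"
      using m pos m0 by (auto simp: dvd_div_eq_0_iff)
    ultimately show "subgroup H G \<and> card (rcosets H) = m"
      using sub_K by simp
  next
    assume H: "subgroup H G \<and> card (rcosets H) = m"
    then have mH: "m * card H = order G"
      using lagrange[of H] by simp
    have "H \<subseteq> K"
    proof
      fix x assume x: "x \<in> H"
      then have "x \<in> carrier G"
        using H subgroup.subset by blast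
      then obtain i :: nat where i: "x = a [^] i"
        using gen by auto
      \<comment> \<open>\<open>H\<close> is a group in its own right, so raising \<open>x\<close> to
        the order of \<open>H\<close> gives the identity. In terms of exponents, i * card H is then
        divisible by the order m * card H of \<open>a\<close>.\<close>
      interpret H: group "G\<lparr>carrier := H\<rparr>"
        using H by (intro subgroup_imp_group) simp
      have "x [^]\<^bsub>G\<lparr>carrier := H\<rparr>\<^esub> card H = \<one>"
        using H.pow_order_eq_1[of x] x by (simp add: order_def)
      then have "a [^] (i * card H) = \<one>"
        using a by (simp add: i nat_pow_pow flip: nat_pow_consistent)
      then have "m * card H dvd i * card H"
        using a by (simp add: pow_eq_id ord_a mH)
      moreover have "card H \<noteq> 0"
        using mH pos by (intro notI) simp
      ultimately have "m dvd i"
        by simp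
      then show "x \<in> K"
        unfolding K_def i by auto
    qed
    moreover have "card H = card K"
      using mH m0 card_K by (metis nonzero_mult_div_cancel_left not_gr_zero)
    moreover have "finite K"
      using sub_K fin by (meson finite_subset subgroup.subset)
    ultimately show "H = K"
      by (simp add: card_subset_eq)
  qed
qed

section \<open>The unit group modulo p and its subgroup of index m\<close>

lemma mult_units_mod [simp]: "x \<otimes>\<^bsub>units_mod p\<^esub> y = x * y mod int p"
  by (simp add: units_mod_def residue_ring_def)

lemma one_units_mod [simp]: "\<one>\<^bsub>units_mod p\<^esub> = 1"
  by (simp add: units_mod_def residue_ring_def)

lemma carrier_units_mod [simp]: "carrier (units_mod p) = {1..<int p}"
  by (auto simp: units_mod_def residue_ring_def)

lemma carrier_complex_units [simp]: "carrier complex_units = UNIV - {0}"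
  and mult_complex_units [simp]: "x \<otimes>\<^bsub>complex_units\<^esub> y = x * y"
  by (simp_all add: complex_units_def)

lemma
  assumes "prime p"
  shows group_units_mod: "group (units_mod p)"
    and units_mod_cyclic: "\<exists>g\<in>carrier (units_mod p). carrier (units_mod p) = range (\<lambda>i::nat. g [^]\<^bsub>units_mod p\<^esub> i)"
proof -
  interpret residues_prime p "residue_ring (int p)"
    using assms by unfold_locales simp_all
  show "group (units_mod p)"
    unfolding units_mod_def by (rule field_mult_group)
  have "finite (carrier (residue_ring (int p)))"
    by (simp add: residue_ring_def)
  from finite_field_mult_group_has_gen[OF this]
  show "\<exists>g\<in>carrier (units_mod p). carrier (units_mod p) = range (\<lambda>i::nat. g [^]\<^bsub>units_mod p\<^esub> i)"
    unfolding units_mod_def nat_pow_mult_of by (simp only: full_SetCompr_eq UNIV_I simp_thms)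
qed

lemma order_units_mod: "order (units_mod p) = p - 1"
  by (simp add: order_def nat_diff_distrib')

lemma mod_in_units_mod:
  assumes "p > 0" "\<not> int p dvd n"
  shows "n mod int p \<in> carrier (units_mod p)"
  using assms pos_mod_sign[of "int p" n] by (auto simp: dvd_eq_mod_eq_0 order_le_less)

text \<open>Evaluates the definite description: \<open>cyclic_index_subgroup_iff\<close> turns its
  defining condition into an equation for the subgroup.\<close>

lemma index_subgroup_eq:
  assumes "prime p" "m dvd p - 1" "g \<in> carrier (units_mod p)"
    and "carrier (units_mod p) = range (\<lambda>i::nat. g [^]\<^bsub>units_mod p\<^esub> i)"
  shows "index_subgroup p m = range (\<lambda>i::nat. g [^]\<^bsub>units_mod p\<^esub> (m * i))"
proof -
  interpret group "units_mod p"
    by (rule group_units_mod) fact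
  have "finite (carrier (units_mod p))"
    by simp
  note cyclic_index_subgroup_iff[OF this assms(3,4), of m]
  then show ?thesis
    unfolding index_subgroup_def using assms(2) by (simp add: order_units_mod)
qed

lemma index_subgroup_subset:
  assumes "prime p" "m dvd p - 1"
  shows "index_subgroup p m \<subseteq> {1..<int p}"
proof -
  interpret group "units_mod p"
    by (rule group_units_mod) fact
  obtain g where g: "g \<in> carrier (units_mod p)"
    "carrier (units_mod p) = range (\<lambda>i::nat. g [^]\<^bsub>units_mod p\<^esub> i)"
    using units_mod_cyclic[OF assms(1)] by blast
  show ?thesis
    unfolding index_subgroup_eq[OF assms g] using nat_pow_closed[OF g(1)] by auto
qed

section \<open>Elementary properties of characters\<close>

lemma character_hom: "\<chi> \<in> characters p \<Longrightarrow> \<chi> \<in> hom (units_mod p) complex_units"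
  by (simp only: characters_def mem_Collect_eq)

lemma character_cases:
  "\<chi> \<in> characters p \<Longrightarrow> \<chi> n = (if int p dvd n then 0 else \<chi> (n mod int p))"
  unfolding characters_def by blast

lemma character_eq_0: "\<chi> \<in> characters p \<Longrightarrow> int p dvd n \<Longrightarrow> \<chi> n = 0"
  by (metis character_cases)

lemma character_mod: "\<chi> \<in> characters p \<Longrightarrow> \<chi> (n mod int p) = \<chi> n"
  by (metis character_cases dvd_mod_iff dvd_refl)

lemma character_mult:
  assumes "prime p" "\<chi> \<in> characters p"
  shows "\<chi> (a * b) = \<chi> a * \<chi> b"
proof (cases "int p dvd a \<or> int p dvd b")
  case True
  then show ?thesis
    using assms(2) by (auto simp: character_eq_0)
next
  case False
  have "\<chi> (a * b) = \<chi> ((a mod int p) \<otimes>\<^bsub>units_mod p\<^esub> (b mod int p))"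
    using character_mod[OF assms(2), of "a * b"] by (simp add: mod_mult_eq)
  also have "\<dots> = \<chi> (a mod int p) * \<chi> (b mod int p)"
    using False hom_mult[OF character_hom[OF assms(2)] mod_in_units_mod mod_in_units_mod]
      prime_gt_0_nat[OF assms(1)] by simp
  finally show ?thesis
    by (simp add: character_mod[OF assms(2)])
qed

lemma character_nonzero:
  assumes "prime p" "\<chi> \<in> characters p" "\<not> int p dvd n"
  shows "\<chi> n \<noteq> 0"
proof -
  have "\<chi> (n mod int p) \<in> carrier complex_units"
    using hom_in_carrier[OF character_hom[OF assms(2)] mod_in_units_mod]
      prime_gt_0_nat[OF assms(1)] assms(3) by blast
  then show ?thesis
    by (simp add: character_mod[OF assms(2)])
qed

lemma character_1:
  assumes "prime p" "\<chi> \<in> characters p"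
  shows "\<chi> 1 = 1"
  using character_mult[OF assms, of 1 1] character_nonzero[OF assms, of 1] prime_gt_1_nat[OF assms(1)]
  by simp

lemma character_pow:
  assumes "prime p" "\<chi> \<in> characters p"
  shows "\<chi> (x [^]\<^bsub>units_mod p\<^esub> (i::nat)) = \<chi> x ^ i"
proof -
  interpret group "units_mod p"
    by (rule group_units_mod) fact
  show ?thesis
    by (induction i)
      (simp_all add: character_1[OF assms] character_mod[OF assms(2)] character_mult[OF assms])
qed

text \<open>By Lagrange's theorem the value is a root of unity of order dividing p - 1, which is
  positive.\<close>

lemma norm_character:
  assumes "prime p" "\<chi> \<in> characters p" "\<not> int p dvd n"
  shows "norm (\<chi> n) = 1"
proof -
  interpret group "units_mod p"
    by (rule group_units_mod) fact
  have "\<chi> (n mod int p) ^ order (units_mod p) = 1"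
    using pow_order_eq_1[OF mod_in_units_mod[OF prime_gt_0_nat[OF assms(1)] assms(3)]]
    by (simp flip: character_pow[OF assms(1,2)] add: character_1[OF assms(1,2)])
  then show ?thesis
    using prime_gt_1_nat[OF assms(1)] power_eq_1_iff[of "\<chi> n" "p - 1"]
    by (simp add: order_units_mod character_mod[OF assms(2)])
qed

section \<open>Characters as roots of unity, and their orthogonality\<close>

lemma sum_roots_of_unity_power:
  assumes "m > 0"
  shows "(\<Sum>z | z ^ m = 1. z ^ i) = (if m dvd i then of_nat m else (0::complex))"
proof -
  have "(\<Sum>z | z ^ m = 1. z ^ i) = (\<Sum>k<m. cis (2 * pi * real k / real m) ^ i)"
    by (rule sum.reindex_bij_betw[OF Complex.bij_betw_roots_unity[OF assms], symmetric])
  also have "\<dots> = (\<Sum>k<m. unit_exp m (int k * int i))"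
    by (simp add: unit_exp_def Complex.DeMoivre mult_ac)
  finally show ?thesis
    using assms by (simp add: sum_unit_exp)
qed

text \<open>A character is determined by its value at a generator, and triviality on the subgroup
  makes this value an m-th root of unity. Conversely such a root z defines a character sending g^i
  to z^i; this is well defined because \<open>m\<close> divides the order of
  \<open>g\<close>.\<close>

lemma bij_betw_characters_trivial:
  assumes p: "prime p" and m: "m dvd p - 1" and g: "g \<in> carrier (units_mod p)"
    and gen: "carrier (units_mod p) = range (\<lambda>i::nat. g [^]\<^bsub>units_mod p\<^esub> i)"
  shows "bij_betw (\<lambda>\<chi>. \<chi> g) (characters_trivial p m) {z. z ^ m = 1}"
proof -
  interpret group "units_mod p"
    by (rule group_units_mod) fact
  note G = index_subgroup_eq[OF p m g gen]
  have p1: "p > 1"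
    using p by (rule prime_gt_1_nat)
  have m0: "m > 0"
    using m p1 by (auto intro: Nat.gr0I)
  have m_dvd: "m dvd ord g"
    using m ord_generator[OF _ g gen] by (simp add: order_units_mod)
  show ?thesis
    unfolding bij_betw_def
  proof (intro conjI inj_onI equalityI subsetI)
    fix \<chi> \<chi>' assume \<chi>: "\<chi> \<in> characters_trivial p m" "\<chi>' \<in> characters_trivial p m" "\<chi> g = \<chi>' g"
    then have ch: "\<chi> \<in> characters p" "\<chi>' \<in> characters p"
      by (auto simp: characters_trivial_def)
    show "\<chi> = \<chi>'"
    proof
      fix n
      show "\<chi> n = \<chi>' n"
      proof (cases "int p dvd n")
        case False
        then obtain i :: nat where i: "n mod int p = g [^]\<^bsub>units_mod p\<^esub> i"
          using mod_in_units_mod[of p n] p1 unfolding gen by auto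
        have "\<chi> (n mod int p) = \<chi>' (n mod int p)"
          unfolding i using ch \<chi>(3) by (simp add: character_pow[OF p])
        then show ?thesis
          using ch by (simp add: character_mod)
      qed (use ch in \<open>simp add: character_eq_0\<close>)
    qed
  next
    fix z assume "z \<in> (\<lambda>\<chi>. \<chi> g) ` characters_trivial p m"
    then obtain \<chi> where \<chi>: "\<chi> \<in> characters_trivial p m" "z = \<chi> g" by blast
    \<comment> \<open>This element generates the subgroup; a character that is 1 on it takes an m-th
      root of unity as value at \<open>g\<close>.\<close>
    have "g [^]\<^bsub>units_mod p\<^esub> m \<in> index_subgroup p m"
      unfolding G by (rule range_eqI[of _ _ 1]) simp
    then show "z \<in> {z. z ^ m = 1}"
      using \<chi> by (auto simp: characters_trivial_def simp flip: character_pow[OF p])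
  next
    fix z :: complex assume "z \<in> {z. z ^ m = 1}"
    then have z: "z ^ m = 1" by simp
    have z0: "z \<noteq> 0"
      using z m0 by (auto simp: power_0_left)
    have z_mod: "z ^ i = z ^ (i mod m)" for i
    proof -
      have "z ^ i = z ^ (m * (i div m) + i mod m)"
        by simp
      then show ?thesis
        unfolding power_add power_mult z by simp
    qed
    \<comment> \<open>Equal powers of \<open>g\<close> have exponents congruent modulo the order of
      \<open>g\<close>, hence modulo \<open>m\<close>, and powers of \<open>z\<close> depend on the
      exponent only modulo \<open>m\<close>.\<close>
    have z_cong: "z ^ i = z ^ j" if "g [^]\<^bsub>units_mod p\<^esub> i = g [^]\<^bsub>units_mod p\<^esub> j" for i j :: nat
    proof -
      have "int (ord g) dvd int j - int i"
        using int_pow_eq[OF g, of "int i" "int j"] that by (simp add: int_pow_int)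
      then have "int m dvd int j - int i"
        using m_dvd by (meson dvd_trans of_nat_dvd_iff)
      then have "j mod m = i mod m"
        by (metis mod_eq_dvd_iff of_nat_eq_iff of_nat_mod)
      then show ?thesis
        using z_mod by metis
    qed
    \<comment> \<open>An arbitrary discrete logarithm: by \<open>z_cong\<close> the resulting power
      of \<open>z\<close> does not depend on the choice.\<close>
    define dlog where "dlog x = (SOME i::nat. x = g [^]\<^bsub>units_mod p\<^esub> i)" for x
    define \<chi> where "\<chi> n = (if int p dvd n then 0 else z ^ dlog (n mod int p))" for n
    have not_dvd: "\<not> int p dvd x" if "x \<in> carrier (units_mod p)" for x
      using that zdvd_not_zless[of x "int p"] by auto
    have \<chi>_pow: "\<chi> (g [^]\<^bsub>units_mod p\<^esub> i) = z ^ i" for i :: nat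
    proof -
      have c: "g [^]\<^bsub>units_mod p\<^esub> i \<in> carrier (units_mod p)"
        using g by (rule nat_pow_closed)
      have "g [^]\<^bsub>units_mod p\<^esub> i = g [^]\<^bsub>units_mod p\<^esub> dlog (g [^]\<^bsub>units_mod p\<^esub> i)"
        unfolding dlog_def by (rule someI) (rule refl)
      then have "z ^ dlog (g [^]\<^bsub>units_mod p\<^esub> i) = z ^ i"
        by (intro z_cong) simp
      then show ?thesis
        using not_dvd[OF c] c by (simp add: \<chi>_def)
    qed
    have "\<chi> \<in> hom (units_mod p) complex_units"
    proof (rule homI)
      fix x assume "x \<in> carrier (units_mod p)"
      then show "\<chi> x \<in> carrier complex_units"
        using not_dvd z0 by (simp add: \<chi>_def del: carrier_units_mod)
    next
      fix x y assume "x \<in> carrier (units_mod p)" "y \<in> carrier (units_mod p)"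
      then obtain i j :: nat where ij: "x = g [^]\<^bsub>units_mod p\<^esub> i" "y = g [^]\<^bsub>units_mod p\<^esub> j"
        unfolding gen by auto
      have "\<chi> (x \<otimes>\<^bsub>units_mod p\<^esub> y) = \<chi> (g [^]\<^bsub>units_mod p\<^esub> (i + j))"
        using g unfolding ij by (subst nat_pow_mult) simp_all
      also have "\<dots> = \<chi> x * \<chi> y"
        unfolding \<chi>_pow ij by (simp add: power_add)
      finally show "\<chi> (x \<otimes>\<^bsub>units_mod p\<^esub> y) = \<chi> x \<otimes>\<^bsub>complex_units\<^esub> \<chi> y"
        by simp
    qed
    then have "\<chi> \<in> characters p"
      unfolding characters_def by (auto simp: \<chi>_def dvd_mod_iff)
    moreover have "\<chi> x = 1" if "x \<in> index_subgroup p m" for x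
      using that unfolding G by (auto simp: \<chi>_pow power_mult z)
    moreover have "\<chi> g = z"
      using \<chi>_pow[of 1] g by simp
    ultimately show "z \<in> (\<lambda>\<chi>. \<chi> g) ` characters_trivial p m"
      by (auto simp: characters_trivial_def)
  qed
qed

text \<open>Transported from the m-th roots of unity. Finiteness allows the sum over odd characters
  to be extended by zero terms.\<close>

lemma finite_characters_trivial:
  assumes "prime p" "m dvd p - 1"
  shows "finite (characters_trivial p m)"
proof -
  obtain g where g: "g \<in> carrier (units_mod p)"
    "carrier (units_mod p) = range (\<lambda>i::nat. g [^]\<^bsub>units_mod p\<^esub> i)"
    using units_mod_cyclic[OF assms(1)] by blast
  have "m > 0"
    using assms prime_gt_1_nat[of p] by (auto intro: Nat.gr0I)
  then show ?thesis
    using bij_betw_finite[OF bij_betw_characters_trivial[OF assms g]] finite_roots_unity[of m] by simp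
qed

text \<open>Orthogonality over the characters: for x = g^i the bijection with roots of unity turns
  the sum into one of z^i over the m-th roots z, which detects whether \<open>m\<close> divides
  i.\<close>

lemma sum_characters_trivial:
  assumes p: "prime p" and m: "m dvd p - 1" and x: "x \<in> {1..<int p}"
  shows "(\<Sum>\<chi>\<in>characters_trivial p m. \<chi> x) = (if x \<in> index_subgroup p m then of_nat m else 0)"
proof -
  interpret group "units_mod p"
    by (rule group_units_mod) fact
  obtain g where g: "g \<in> carrier (units_mod p)"
    and gen: "carrier (units_mod p) = range (\<lambda>i::nat. g [^]\<^bsub>units_mod p\<^esub> i)"
    using units_mod_cyclic[OF p] by blast
  note G = index_subgroup_eq[OF p m g gen]
  have p1: "p > 1"
    using p by (rule prime_gt_1_nat)
  have m0: "m > 0"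
    using m p1 by (auto intro: Nat.gr0I)
  have m_dvd: "m dvd ord g"
    using m ord_generator[OF _ g gen] by (simp add: order_units_mod)
  obtain i :: nat where i: "x = g [^]\<^bsub>units_mod p\<^esub> i"
    using x gen unfolding carrier_units_mod by blast
  \<comment> \<open>The exponent is determined only modulo the order of \<open>g\<close>, but
    \<open>m\<close> divides that order.\<close>
  have "x \<in> index_subgroup p m \<longleftrightarrow> m dvd i"
  proof
    assume "x \<in> index_subgroup p m"
    then obtain j :: nat where "g [^]\<^bsub>units_mod p\<^esub> i = g [^]\<^bsub>units_mod p\<^esub> (m * j)"
      unfolding G i by auto
    then have "int (ord g) dvd int (m * j) - int i"
      using int_pow_eq[OF g, of "int i" "int (m * j)"] by (simp add: int_pow_int del: of_nat_mult)
    then have "int m dvd int (m * j) - int i"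
      using m_dvd by (meson dvd_trans of_nat_dvd_iff)
    then have "int m dvd int i"
      by (simp add: dvd_diff_right_iff)
    then show "m dvd i"
      by simp
  qed (auto simp: G i)
  moreover have "(\<Sum>\<chi>\<in>characters_trivial p m. \<chi> x) = (\<Sum>\<chi>\<in>characters_trivial p m. \<chi> g ^ i)"
    unfolding i by (intro sum.cong) (auto simp: characters_trivial_def character_pow[OF p])
  moreover have "\<dots> = (\<Sum>z | z ^ m = 1. z ^ i)"
    by (rule sum.reindex_bij_betw[OF bij_betw_characters_trivial[OF p m g gen]])
  ultimately show ?thesis
    using m0 by (simp add: sum_roots_of_unity_power)
qed

section \<open>The fourth moment\<close>

lemma not_int_dvd_less: "a \<in> {1..<p} \<Longrightarrow> \<not> int p dvd int a"
  by (auto dest!: dvd_imp_le)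

text \<open>Multiplication by a unit permutes the nonzero residues; injectivity suffices because the
  set is finite. Every multiplicative substitution in the character sums below rests on
  this.\<close>

lemma sum_mult_unit_mod_prime:
  fixes f :: "int \<Rightarrow> 'a::comm_monoid_add"
  assumes p: "prime p" and d: "\<not> int p dvd d" and per: "\<And>n. f (n mod int p) = f n"
  shows "(\<Sum>a=1..<p. f (int a * d)) = (\<Sum>a=1..<p. f (int a))"
proof -
  have p0: "p > 0"
    using p by (rule prime_gt_0_nat)
  define \<pi> where "\<pi> a = nat (int a * d mod int p)" for a
  have \<pi>: "int (\<pi> a) = int a * d mod int p" for a
    using p0 by (simp add: \<pi>_def)
  have pp: "prime (int p)"
    using p by simp
  have "inj_on \<pi> {1..<p}"
  proof (rule inj_onI)
    fix a b assume ab: "a \<in> {1..<p}" "b \<in> {1..<p}" "\<pi> a = \<pi> b"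
    then have "int a * d mod int p = int b * d mod int p"
      using \<pi> by metis
    then have "int p dvd (int a - int b) * d"
      by (simp add: mod_eq_dvd_iff left_diff_distrib)
    then have "int p dvd int a - int b"
      using d prime_dvd_multD[OF pp] by blast
    then have "int a mod int p = int b mod int p"
      by (simp add: mod_eq_dvd_iff)
    then show "a = b"
      using ab by simp
  qed
  moreover have "\<pi> ` {1..<p} \<subseteq> {1..<p}"
  proof
    fix x assume "x \<in> \<pi> ` {1..<p}"
    then obtain a where a: "a \<in> {1..<p}" "x = \<pi> a" by blast
    have "\<not> int p dvd int a"
      using a(1) by (auto dest!: dvd_imp_le)
    then have "int (\<pi> a) \<noteq> 0"
      unfolding \<pi> dvd_eq_mod_eq_0[symmetric] using d prime_dvd_multD[OF pp, of "int a" d] by blast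
    moreover have "int (\<pi> a) < int p"
      unfolding \<pi> using p0 by simp
    ultimately show "x \<in> {1..<p}"
      using a by simp
  qed
  ultimately have "bij_betw \<pi> {1..<p} {1..<p}"
    by (auto simp: bij_betw_def endo_inj_surj)
  then have "(\<Sum>a=1..<p. f (int a)) = (\<Sum>a=1..<p. f (int (\<pi> a)))"
    by (rule sum.reindex_bij_betw[symmetric])
  then show ?thesis
    by (simp add: \<pi> per)
qed

text \<open>Shifting the argument by an integer multiple of pi multiplies sine and cosine by the
  same sign, which cancels in the quotient.\<close>

lemma cot_mod:
  assumes "p > 0"
  shows "cot (pi * real_of_int (k mod int p) / real p) = cot (pi * real_of_int k / real p)"
proof -
  have "real_of_int k = real_of_int (k div int p) * real p + real_of_int (k mod int p)"
    using arg_cong[OF div_mult_mod_eq[of k "int p"], of real_of_int]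
    by (simp only: of_int_add of_int_mult of_int_of_nat_eq)
  then have "pi * real_of_int k / real p =
      pi * real_of_int (k mod int p) / real p + pi * real_of_int (k div int p)"
    using assms by (simp add: field_simps)
  moreover have "cos (pi * real_of_int (k div int p)) \<noteq> 0"
    by simp
  ultimately show ?thesis
    by (simp add: cot_def sin_add cos_add)
qed

lemma dedekind_sum_mod:
  assumes "p > 0"
  shows "dedekind_sum (c mod int p) p = dedekind_sum c p"
proof -
  have "sawtooth (real a * real_of_int (c mod int p) / real p) = sawtooth (real a * real_of_int c / real p)" for a
    using sawtooth_mod[OF assms, of "int a * (c mod int p)"] sawtooth_mod[OF assms, of "int a * c"]
    by (simp add: mod_mult_right_eq)
  then show ?thesis
    by (simp add: dedekind_sum_def)
qed

lemma dedekind_sum_uminus: "dedekind_sum (- c) p = - dedekind_sum c p"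
  by (simp add: dedekind_sum_def sawtooth_uminus sum_negf)

text \<open>The multiplicative Fourier coefficient of s(c,p) as a function of \<open>c\<close>,
  taken without conjugating the character.\<close>

definition twisted_dedekind_sum :: "nat \<Rightarrow> (int \<Rightarrow> complex) \<Rightarrow> complex" where
  "twisted_dedekind_sum p \<chi> = (\<Sum>c=1..<p. \<chi> (int c) * of_real (dedekind_sum (int c) p))"

section \<open>Twisted Dedekind sums for a single character\<close>

context
  fixes p :: nat and \<chi> :: "int \<Rightarrow> complex"
  assumes p: "prime p" and \<chi>: "\<chi> \<in> characters p"
begin

lemma character_mult_cnj: "a \<in> {1..<p} \<Longrightarrow> \<chi> (int a) * cnj (\<chi> (int a)) = 1"
  using norm_character[OF p \<chi> not_int_dvd_less, of a] by (simp add: complex_norm_square[symmetric])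

text \<open>With s(c,p) written as a sum of products of cotangents over \<open>k\<close>, the
  substitution of ck for \<open>c\<close> makes the inner sum independent of \<open>k\<close>. The
  sum over \<open>k\<close> that remains is its conjugate, as cotangents are real.\<close>

lemma twisted_dedekind_sum_eq_cot:
  "4 * of_nat p * twisted_dedekind_sum p \<chi> =
     of_real ((norm (\<Sum>k<p. \<chi> (int k) * of_real (cot (pi * real k / real p))))\<^sup>2)"
proof -
  have p0: "p > 0"
    using p by (rule prime_gt_0_nat)
  define ct where "ct k = complex_of_real (cot (pi * real_of_int k / real p))" for k
  have ct_mod: "ct (k mod int p) = ct k" for k
    using cot_mod[OF p0] by (simp add: ct_def)
  define C where "C = (\<Sum>k=1..<p. \<chi> (int k) * ct (int k))"
  have from1: "(\<Sum>k<p. h k * ct (int k)) = (\<Sum>k=1..<p. h k * ct (int k))" for h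
    by (rule sum.mono_neutral_right) (auto simp: ct_def Suc_le_eq)
  have "4 * of_nat p * of_real (dedekind_sum c p) = (\<Sum>k=1..<p. ct (c * int k) * ct (int k))" for c
    using arg_cong[OF sum_cot_mult_cot[OF p0, of c], of complex_of_real]
    unfolding from1[symmetric] by (simp add: ct_def mult.commute)
  then have "4 * of_nat p * (\<chi> (int c) * of_real (dedekind_sum (int c) p)) =
      \<chi> (int c) * (\<Sum>k=1..<p. ct (int c * int k) * ct (int k))" for c
    by (metis mult.left_commute)
  then have "4 * of_nat p * twisted_dedekind_sum p \<chi> =
      (\<Sum>c=1..<p. \<chi> (int c) * (\<Sum>k=1..<p. ct (int c * int k) * ct (int k)))"
    by (simp only: twisted_dedekind_sum_def sum_distrib_left[of "4 * of_nat p"])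
  also have "\<dots> = (\<Sum>k=1..<p. \<Sum>c=1..<p. \<chi> (int c) * (ct (int c * int k) * ct (int k)))"
    unfolding sum_distrib_left by (rule sum.swap)
  also have "\<dots> = (\<Sum>k=1..<p. cnj (\<chi> (int k)) * ct (int k) * C)"
  proof (rule sum.cong)
    fix k assume k: "k \<in> {1..<p}"
    \<comment> \<open>The conjugate of the value at the unit \<open>k\<close> is its inverse, so the
      value at \<open>c\<close> is that conjugate times the value at ck.\<close>
    have "\<chi> (int c) * (ct (int c * int k) * ct (int k)) =
        cnj (\<chi> (int k)) * ct (int k) * (\<chi> (int c * int k) * ct (int c * int k))" for c
      using character_mult_cnj[OF k] by (simp add: character_mult[OF p \<chi>] algebra_simps)
    then have "(\<Sum>c=1..<p. \<chi> (int c) * (ct (int c * int k) * ct (int k))) =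
        cnj (\<chi> (int k)) * ct (int k) * (\<Sum>c=1..<p. \<chi> (int c * int k) * ct (int c * int k))"
      by (simp only: sum_distrib_left)
    also have "(\<Sum>c=1..<p. \<chi> (int c * int k) * ct (int c * int k)) = C"
      unfolding C_def using sum_mult_unit_mod_prime[OF p not_int_dvd_less[OF k], of "\<lambda>n. \<chi> n * ct n"]
      by (simp add: character_mod[OF \<chi>] ct_mod)
    finally show "(\<Sum>c=1..<p. \<chi> (int c) * (ct (int c * int k) * ct (int k))) =
        cnj (\<chi> (int k)) * ct (int k) * C" .
  qed simp
  also have "\<dots> = C * cnj C"
    unfolding C_def cnj_sum by (simp add: sum_distrib_left sum_distrib_right ct_def mult_ac)
  also have "C = (\<Sum>k<p. \<chi> (int k) * ct (int k))"
    unfolding C_def from1 ..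
  finally show ?thesis
    by (simp only: ct_def complex_norm_square of_int_of_nat_eq)
qed

lemma character_minus_1_cases: "\<chi> (- 1) = 1 \<or> \<chi> (- 1) = - 1"
  using character_mult[OF p \<chi>, of "-1" "-1"] character_1[OF p \<chi>]
  by (simp flip: power2_eq_square add: power2_eq_1_iff)

text \<open>Replacing \<open>c\<close> by its negative fixes the character value and flips the sign
  of the Dedekind sum, so the sum equals its own negative.\<close>

lemma twisted_dedekind_sum_even:
  assumes "\<chi> (- 1) = 1"
  shows "twisted_dedekind_sum p \<chi> = 0"
proof -
  have "\<not> int p dvd - 1"
    using prime_gt_1_nat[OF p] by auto
  then have "(\<Sum>a=1..<p. \<chi> (int a * - 1) * complex_of_real (dedekind_sum (int a * - 1) p)) =
      twisted_dedekind_sum p \<chi>"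
    unfolding twisted_dedekind_sum_def
    by (rule sum_mult_unit_mod_prime[OF p]) (simp add: character_mod[OF \<chi>] dedekind_sum_mod[OF prime_gt_0_nat[OF p]])
  moreover have "(\<Sum>a=1..<p. \<chi> (int a * - 1) * complex_of_real (dedekind_sum (int a * - 1) p)) =
      - twisted_dedekind_sum p \<chi>"
    unfolding twisted_dedekind_sum_def character_mult[OF p \<chi>] assms
    by (simp add: dedekind_sum_uminus sum_negf)
  ultimately show ?thesis
    by simp
qed

text \<open>Combines the cotangent formula for the series with
  \<open>twisted_dedekind_sum_eq_cot\<close>; the constants multiply to (pi/(2p))^4 * (4p)^2 =
  pi^4/p^2.\<close>

lemma norm_L_one_odd:
  assumes "\<chi> (- 1) = - 1"
  shows "norm (L_one \<chi>) ^ 4 = pi ^ 4 / (real p)\<^sup>2 * (norm (twisted_dedekind_sum p \<chi>))\<^sup>2"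
proof -
  have p0: "p > 0"
    using p by (rule prime_gt_0_nat)
  define C where "C = (\<Sum>k<p. \<chi> (int k) * complex_of_real (cot (pi * real k / real p)))"
  have "\<chi> (- n) = - \<chi> n" for n
    using character_mult[OF p \<chi>, of "-1" n] assms by simp
  then have "L_one \<chi> = of_real (pi / (2 * real p)) * C"
    unfolding L_one_def C_def
    by (intro sums_unique[symmetric] odd_periodic_sums_cot p0 character_mod[OF \<chi>])
  then have "norm (L_one \<chi>) = pi / (2 * real p) * norm C"
    by (simp add: norm_mult norm_divide)
  then have "norm (L_one \<chi>) ^ 4 = (pi / (2 * real p)) ^ 4 * ((norm C)\<^sup>2)\<^sup>2"
    by (simp add: power_mult_distrib power_divide)
  \<comment> \<open>The square is a nonnegative real, so taking norms in
    \<open>twisted_dedekind_sum_eq_cot\<close> leaves it unchanged.\<close>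
  also have "(norm C)\<^sup>2 = 4 * real p * norm (twisted_dedekind_sum p \<chi>)"
    using arg_cong[OF twisted_dedekind_sum_eq_cot, of norm] unfolding C_def[symmetric]
    by (simp add: norm_mult norm_power)
  finally show ?thesis
    using p0 by (simp add: field_simps power2_eq_square power4_eq_xxxx)
qed

text \<open>In the double sum over c and d for the product with the conjugate, setting c = ld leaves
  the character value at \<open>l\<close> alone, and the sum over d becomes the correlation of
  Dedekind sums. This form is linear in the character, ready for orthogonality.\<close>

lemma norm_twisted_dedekind_sum:
  "of_real ((norm (twisted_dedekind_sum p \<chi>))\<^sup>2) =
     (\<Sum>l=1..<p. of_real (dedekind_corr (int l) 1 p) * \<chi> (int l))"
proof -
  have p0: "p > 0"
    using p by (rule prime_gt_0_nat)
  define s where "s c = complex_of_real (dedekind_sum c p)" for c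
  have "of_real ((norm (twisted_dedekind_sum p \<chi>))\<^sup>2) =
      twisted_dedekind_sum p \<chi> * cnj (twisted_dedekind_sum p \<chi>)"
    by (rule complex_norm_square)
  \<comment> \<open>Only the conjugated factor is expanded; the other stays whole so that its
    summation variable can be rescaled by each \<open>d\<close>.\<close>
  also have "\<dots> = (\<Sum>d=1..<p. twisted_dedekind_sum p \<chi> * (cnj (\<chi> (int d)) * s (int d)))"
    by (subst (2) twisted_dedekind_sum_def) (simp add: sum_distrib_left s_def)
  also have "\<dots> = (\<Sum>d=1..<p. \<Sum>l=1..<p. \<chi> (int l) * (s (int l * int d) * s (int d)))"
  proof (rule sum.cong)
    fix d assume d: "d \<in> {1..<p}"
    have "twisted_dedekind_sum p \<chi> = (\<Sum>l=1..<p. \<chi> (int l * int d) * s (int l * int d))"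
      unfolding twisted_dedekind_sum_def s_def
      by (rule sum_mult_unit_mod_prime[OF p not_int_dvd_less[OF d], symmetric])
        (simp add: character_mod[OF \<chi>] dedekind_sum_mod[OF p0])
    also have "\<dots> * (cnj (\<chi> (int d)) * s (int d)) =
        (\<Sum>l=1..<p. \<chi> (int l) * (s (int l * int d) * s (int d)))"
      unfolding sum_distrib_right
      using character_mult_cnj[OF d] by (intro sum.cong) (simp_all add: character_mult[OF p \<chi>] algebra_simps)
    finally show "twisted_dedekind_sum p \<chi> * (cnj (\<chi> (int d)) * s (int d)) =
        (\<Sum>l=1..<p. \<chi> (int l) * (s (int l * int d) * s (int d)))" .
  qed simp
  also have "\<dots> = (\<Sum>l=1..<p. \<Sum>d=1..<p. \<chi> (int l) * (s (int l * int d) * s (int d)))"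
    by (rule sum.swap)
  also have "\<dots> = (\<Sum>l=1..<p. of_real (dedekind_corr (int l) 1 p) * \<chi> (int l))"
  proof -
    have "{1..p - 1} = {1..<p}"
      using p0 by auto
    then show ?thesis
      by (simp add: dedekind_corr_def s_def sum_distrib_left mult_ac)
  qed
  finally show ?thesis .
qed

end

section \<open>Summation over the characters trivial on the subgroup\<close>

theorem theorem2p7:
  fixes p m :: nat
  assumes "prime p" and "m dvd p - 1" and "even m"
  shows "moment 4 p m =
    2 * pi ^ 4 / (real p)\<^sup>2 * (\<Sum>l\<in>index_subgroup p m. dedekind_corr l 1 p)"
proof -
  let ?X = "characters_trivial p m" and ?A = "twisted_dedekind_sum p"
  have m0: "m > 0"
    using assms(2) prime_gt_1_nat[OF assms(1)] by (auto intro: Nat.gr0I)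
  have ch: "\<chi> \<in> characters p" if "\<chi> \<in> ?X" for \<chi>
    using that by (simp add: characters_trivial_def)
  have "(\<Sum>\<chi>\<in>odd_characters p m. norm (L_one \<chi>) ^ 4) =
      (\<Sum>\<chi>\<in>odd_characters p m. pi ^ 4 / (real p)\<^sup>2 * (norm (?A \<chi>))\<^sup>2)"
    by (intro sum.cong refl norm_L_one_odd[OF assms(1)]) (auto simp: odd_characters_def ch)
  \<comment> \<open>A character that is not odd takes the value 1 at -1, so its twisted sum is 0.
    The range thus extends to the whole group of characters, where orthogonality is
    available.\<close>
  also have "\<dots> = (\<Sum>\<chi>\<in>?X. pi ^ 4 / (real p)\<^sup>2 * (norm (?A \<chi>))\<^sup>2)"
  proof (rule sum.mono_neutral_left)
    show "\<forall>\<chi>\<in>?X - odd_characters p m. pi ^ 4 / (real p)\<^sup>2 * (norm (?A \<chi>))\<^sup>2 = 0"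
    proof
      fix \<chi> assume "\<chi> \<in> ?X - odd_characters p m"
      then have "\<chi> \<in> characters p" "\<chi> (- 1) \<noteq> - 1"
        by (auto simp: odd_characters_def ch)
      then have "?A \<chi> = 0"
        using character_minus_1_cases[OF assms(1)] twisted_dedekind_sum_even[OF assms(1)] by blast
      then show "pi ^ 4 / (real p)\<^sup>2 * (norm (?A \<chi>))\<^sup>2 = 0"
        by simp
    qed
  qed (use finite_characters_trivial[OF assms(1,2)] in \<open>auto simp: odd_characters_def\<close>)
  also have "\<dots> = pi ^ 4 / (real p)\<^sup>2 * (\<Sum>\<chi>\<in>?X. (norm (?A \<chi>))\<^sup>2)"
    by (rule sum_distrib_left[symmetric])
  also have "(\<Sum>\<chi>\<in>?X. (norm (?A \<chi>))\<^sup>2) = real m * (\<Sum>l\<in>index_subgroup p m. dedekind_corr l 1 p)"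
  proof -
    \<comment> \<open>This identity between reals is proved over the complex numbers, where the
      character values lie.\<close>
    have "complex_of_real (\<Sum>\<chi>\<in>?X. (norm (?A \<chi>))\<^sup>2) =
        (\<Sum>\<chi>\<in>?X. \<Sum>l=1..<p. of_real (dedekind_corr (int l) 1 p) * \<chi> (int l))"
      unfolding of_real_sum by (intro sum.cong refl norm_twisted_dedekind_sum assms ch)
    also have "\<dots> = (\<Sum>l=1..<p. \<Sum>\<chi>\<in>?X. of_real (dedekind_corr (int l) 1 p) * \<chi> (int l))"
      by (rule sum.swap)
    also have "\<dots> = (\<Sum>l=1..<p. of_real (dedekind_corr (int l) 1 p) *
        (if int l \<in> index_subgroup p m then of_nat m else 0))"
      unfolding sum_distrib_left[symmetric]
      by (intro sum.cong refl arg_cong2[where f = "(*)"] sum_characters_trivial[OF assms(1,2)]) auto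
    \<comment> \<open>The subgroup is a set of integers, so the index changes type before the sum is
      restricted to it.\<close>
    also have "\<dots> = (\<Sum>l\<in>{1..<int p}. of_real (dedekind_corr l 1 p) *
        (if l \<in> index_subgroup p m then of_nat m else 0))"
      using image_int_atLeastLessThan[of 1 p] by (subst sum.reindex_cong[of int "{1..<p}"]) auto
    also have "\<dots> = (\<Sum>l\<in>index_subgroup p m. of_real (dedekind_corr l 1 p) *
        (if l \<in> index_subgroup p m then of_nat m else 0))"
      using index_subgroup_subset[OF assms(1,2)] by (intro sum.mono_neutral_right) auto
    also have "\<dots> = complex_of_real (real m * (\<Sum>l\<in>index_subgroup p m. dedekind_corr l 1 p))"
      by (simp add: sum_distrib_left mult_ac)
    finally show ?thesis
      by (simp only: of_real_eq_iff)
  qed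
  \<comment> \<open>The factor \<open>m\<close> produced by orthogonality cancels against the
    normalisation 2/m of \<open>moment\<close>.\<close>
  finally show ?thesis
    using m0 by (simp add: moment_def)
qed

end
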